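(* Let $D(t)\in\mathbb{Q}[t]$ be a nonconstant polynomial whose Pell equation has a fundamental solution $(u,v)$ with $u,v\in\mathbb{Q}[t]$. Then: (1) There are no linear polynomials with coefficients in $\mathbb{Q}$ that divide $v^{\mathrm{new}}_n(t)$, for any integer $n\geq 4$. (2) There are no quadratic polynomials with coefficients in $\mathbb{Q}$ that divide $v^{\mathrm{new}}_n(t)$, for any integer $n\geq 7$.
   Context: For $D$ nonconstant, Pell's equation for $D$ is $x^2-Dy^2=1$ with $x,y\in\mathbb{C}[t]$. A fundamental solution is a solution $(u,v)$ with $v\neq 0$ of minimal degree among all solutions with $y\neq0$. For integers $n\geq 1$ define $u_n,v_n$ by $u_n+v_n\sqrt{D}=(u+v\sqrt{D})^n$. The "new part" $v^{\mathrm{new}}_n$ of $v_n$ is the polynomial determined by $v_n=\prod_{m\mid n}v^{\mathrm{new}}_m$ for all $n\geq 1$; equivalently $v^{\mathrm{new}}_n=\prod_{m\mid n}v_m^{\mu(n/m)}$, where $\mu$ is the Möbius function. *)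

theory Defs
  imports Complex_Main "HOL-Computational_Algebra.Computational_Algebra"
begin

text \<open>
  The ring \<open>\<rat>[t]\<close> is treated as a subring of \<open>\<complex>[t]\<close>, so that all polynomials have type
  \<^typ>\<open>complex poly\<close>.
\<close>

definition rational_poly :: "complex poly \<Rightarrow> bool" where
  "rational_poly p \<longleftrightarrow> (\<forall>i. coeff p i \<in> \<rat>)"

definition pell_solution :: "complex poly \<Rightarrow> complex poly \<Rightarrow> complex poly \<Rightarrow> bool" where
  "pell_solution D x y \<longleftrightarrow> x^2 - D * y^2 = 1"

text \<open>
  The degree of a solution \<open>(x, y)\<close> is read as the degree of \<open>x\<close>. By the lemma
  \<open>pell_solution_degree\<close> below, minimising the degree of \<open>y\<close> instead gives the same notion.
\<close>

definition fundamental_solution :: "complex poly \<Rightarrow> complex poly \<Rightarrow> complex poly \<Rightarrow> bool" where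
  "fundamental_solution D u v \<longleftrightarrow>
     pell_solution D u v \<and> v \<noteq> 0 \<and>
     (\<forall>x y. pell_solution D x y \<and> y \<noteq> 0 \<longrightarrow> degree u \<le> degree x)"

text \<open>
  The pair \<open>(a, b)\<close> stands for \<open>a + b\<surd>D\<close>. The lemma \<open>pell_pow_cong\<close> below states the equation
  \<open>u\<^sub>n + v\<^sub>n\<surd>D = (u + v\<surd>D)\<^sup>n\<close> in \<open>\<complex>[t][X]/(X\<^sup>2 - D)\<close>.
\<close>

primrec pell_pow ::
    "complex poly \<Rightarrow> complex poly \<Rightarrow> complex poly \<Rightarrow> nat \<Rightarrow> complex poly \<times> complex poly" where
  "pell_pow D u v 0 = (1, 0)"
| "pell_pow D u v (Suc n) =
     (let (a, b) = pell_pow D u v n in (u * a + D * v * b, u * b + v * a))"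

definition pell_u :: "complex poly \<Rightarrow> complex poly \<Rightarrow> complex poly \<Rightarrow> nat \<Rightarrow> complex poly" where
  "pell_u D u v n = fst (pell_pow D u v n)"

definition pell_v :: "complex poly \<Rightarrow> complex poly \<Rightarrow> complex poly \<Rightarrow> nat \<Rightarrow> complex poly" where
  "pell_v D u v n = snd (pell_pow D u v n)"

text \<open>
  The relation \<open>v\<^sub>n = (\<Prod>m | m dvd n. v\<^sub>m\<^sup>n\<^sup>e\<^sup>w)\<close>, solved recursively for the factor with \<open>m = n\<close>.
  The division is exact: see \<open>pell_v_eq_prod_new\<close> and \<open>pell_v_new_unique\<close> below.
\<close>

function pell_v_new ::
    "complex poly \<Rightarrow> complex poly \<Rightarrow> complex poly \<Rightarrow> nat \<Rightarrow> complex poly" where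
  "pell_v_new D u v n =
     pell_v D u v n div (\<Prod>m\<in>{m. m dvd n \<and> m < n}. pell_v_new D u v m)"
  by auto
termination by (relation "measure (\<lambda>(D, u, v, n). n)") auto

declare pell_v_new.simps [simp del]

subsection \<open>The definitions meet their specifications\<close>

lemma pell_solution_degree:
  assumes "pell_solution D x y" "y \<noteq> 0" "degree D > 0"
  shows "2 * degree x = degree D + 2 * degree y"
proof -
  have "x^2 = D * y^2 + 1" using assms by (simp add: pell_solution_def algebra_simps)
  moreover have D: "degree (D * y^2) = degree D + 2 * degree y"
    using assms by (subst degree_mult_eq) (auto simp: degree_power_eq)
  moreover have "degree (D * y^2 + 1) = degree (D * y^2)"
    by (rule degree_add_eq_left) (use D assms in simp)
  moreover from calculation have "x \<noteq> 0" using assms by auto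
  ultimately show ?thesis by (metis degree_power_eq)
qed

lemma pell_pow_Suc:
  "pell_u D u v 0 = 1" "pell_v D u v 0 = 0"
  "pell_u D u v (Suc n) = u * pell_u D u v n + D * v * pell_v D u v n"
  "pell_v D u v (Suc n) = u * pell_v D u v n + v * pell_u D u v n"
  by (simp_all add: pell_u_def pell_v_def case_prod_beta)

lemma pell_pow_cong:
  "[:-D, 0, 1:] dvd [:u, v:] ^ n - [:pell_u D u v n, pell_v D u v n:]"
proof (induction n)
  case (Suc n)
  let ?p = "[:pell_u D u v n, pell_v D u v n:]"
  have "[:u, v:] ^ Suc n - [:pell_u D u v (Suc n), pell_v D u v (Suc n):] =
        [:u, v:] * ([:u, v:] ^ n - ?p) + [:v * pell_v D u v n:] * [:-D, 0, 1:]"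
    by (simp add: pell_pow_Suc algebra_simps)
  also have "[:-D, 0, 1:] dvd \<dots>" by (intro dvd_add dvd_mult Suc dvd_refl)
  finally show ?case .
qed (simp_all add: pell_pow_Suc one_pCons)

text \<open>
  Shifted Chebyshev polynomials of the second kind: \<open>chebS n = U\<^bsub>n-1\<^esub>\<close>. They give
  \<open>v\<^sub>n = v U\<^bsub>n-1\<^esub>(u)\<close>, and \<open>v\<^sub>n\<^sup>n\<^sup>e\<^sup>w\<close> collects the factors \<open>2u - 2cos(\<pi>k/n)\<close> with \<open>k\<close> coprime to \<open>n\<close>.
\<close>

fun chebS :: "nat \<Rightarrow> complex poly" where
  "chebS 0 = 0"
| "chebS (Suc 0) = 1"
| "chebS (Suc (Suc n)) = [:0, 2:] * chebS (Suc n) - chebS n"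

lemma pell_v_chebS:
  assumes "pell_solution D u v"
  shows "pell_v D u v n = v * pcompose (chebS n) u"
proof (induction n rule: chebS.induct)
  case (3 n)
  have D: "D * v^2 = u^2 - 1" using assms by (simp add: pell_solution_def algebra_simps)
  have "pell_v D u v (Suc (Suc n)) =
          u * pell_v D u v (Suc n) + u * (v * pell_u D u v n) + (D * v^2) * pell_v D u v n"
    by (simp add: pell_pow_Suc(3,4) algebra_simps power2_eq_square)
  also have "\<dots> = 2 * u * pell_v D u v (Suc n) - pell_v D u v n"
    unfolding D by (simp add: pell_pow_Suc(4) algebra_simps power2_eq_square)
  finally show ?case
    using 3 by (simp add: pcompose_diff pcompose_mult pcompose_pCons algebra_simps numeral_poly
        pcompose_smult)
qed (simp_all add: pell_pow_Suc pcompose_1)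

lemma chebS_degree: "degree (chebS n) \<le> n - 1" "coeff (chebS (Suc n)) n = 2 ^ n"
proof -
  have *: "degree (chebS n) \<le> n - 1 \<and> degree (chebS (Suc n)) \<le> n" for n
  proof (induction n)
    case (Suc n)
    have "degree ([:0, 2:] * chebS (Suc n)) \<le> Suc n"
      using Suc by (intro order.trans[OF degree_mult_le]) auto
    then show ?case using Suc by (auto intro!: degree_diff_le)
  qed auto
  then show "degree (chebS n) \<le> n - 1" by blast
  show "coeff (chebS (Suc n)) n = 2 ^ n"
  proof (induction n)
    case (Suc n)
    have "coeff (chebS n) (Suc n) = 0"
      using *[of n] by (intro coeff_eq_0) auto
    then show ?case using Suc by (simp add: coeff_pCons)
  qed simp
qed

lemma chebS_cos:
  "poly (chebS n) (of_real (cos x)) * of_real (sin x) = of_real (sin (real n * x))"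
proof (induction n rule: chebS.induct)
  case (3 n)
  have s: "sin (real (Suc (Suc n)) * x) = 2 * cos x * sin (real (Suc n) * x) - sin (real n * x)"
  proof -
    have "sin (real (Suc (Suc n)) * x) = sin (real (Suc n) * x + x)"
         "sin (real n * x) = sin (real (Suc n) * x - x)"
      by (simp_all add: algebra_simps)
    then show ?thesis by (simp only: sin_add sin_diff) simp
  qed
  have "poly (chebS (Suc (Suc n))) (of_real (cos x)) * of_real (sin x) =
          2 * of_real (cos x) * (poly (chebS (Suc n)) (of_real (cos x)) * of_real (sin x)) -
          poly (chebS n) (of_real (cos x)) * of_real (sin x)"
    by (simp add: algebra_simps)
  also have "\<dots> = of_real (2 * cos x * sin (real (Suc n) * x) - sin (real n * x))"
    by (simp only: 3) simp
  finally show ?case by (simp only: s)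
qed auto

definition chebR :: "real \<Rightarrow> complex poly" where
  "chebR r = [:- 2 * of_real (cos (pi * r)), 2:]"

lemma degree_chebR: "degree (chebR r) = 1" "coeff (chebR r) (Suc 0) = 2" "chebR r \<noteq> 0"
  by (simp_all add: chebR_def)

lemma chebS_prod:
  assumes "n > 0"
  shows "chebS n = (\<Prod>k\<in>{1..<n}. chebR (real k / real n))"
proof -
  let ?f = "\<lambda>k. complex_of_real (cos (pi * (real k / real n)))"
  have deg: "degree (\<Prod>k\<in>{1..<n}. chebR (real k / real n)) = n - 1"
    by (subst degree_prod_eq_sum_degree) (simp_all add: degree_chebR)
  have lc: "coeff (\<Prod>k\<in>{1..<n}. chebR (real k / real n)) (n - 1) = 2 ^ (n - 1)"
    using lead_coeff_prod[of "\<lambda>k. chebR (real k / real n)" "{1..<n}"]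
    unfolding deg by (simp add: degree_chebR)
  have inj: "inj_on ?f {1..<n}"
  proof (rule inj_onI)
    fix j k assume jk: "j \<in> {1..<n}" "k \<in> {1..<n}" "?f j = ?f k"
    have "pi * (real i / real n) \<le> pi * 1" if "i \<in> {1..<n}" for i
      using that by (intro mult_left_mono) auto
    then have "pi * (real j / real n) \<le> pi" "pi * (real k / real n) \<le> pi"
      using jk(1,2) by (metis mult.right_neutral)+
    moreover have "cos (pi * (real j / real n)) = cos (pi * (real k / real n))"
      using jk(3) by (simp only: of_real_eq_iff)
    ultimately have "pi * (real j / real n) = pi * (real k / real n)"
      by (metis cos_inj_pi divide_nonneg_nonneg mult_nonneg_nonneg of_nat_0_le_iff pi_ge_zero)
    then show "j = k" using assms by simp
  qed
  show ?thesis
  proof (rule poly_eqI_degree_lead_coeff[where n = "n - 1" and A = "?f ` {1..<n}"])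
    show "coeff (chebS n) (n - 1) = coeff (\<Prod>k\<in>{1..<n}. chebR (real k / real n)) (n - 1)"
      using chebS_degree(2)[of "n - 1"] assms lc by simp
    show "n - 1 \<le> card (?f ` {1..<n})" using inj by (simp add: card_image)
    fix z assume "z \<in> ?f ` {1..<n}"
    then obtain k where k: "k \<in> {1..<n}" and z: "z = ?f k" by blast
    let ?x = "pi * (real k / real n)"
    have "?x < pi * 1" using k by (intro mult_strict_left_mono) auto
    then have "sin ?x > 0" using k by (intro sin_gt_zero) simp_all
    moreover have "sin (real n * ?x) = 0"
      using assms by (simp add: sin_npi2 mult.commute)
    ultimately have "poly (chebS n) z = 0" using chebS_cos[of n ?x] z by simp
    moreover have "poly (\<Prod>k\<in>{1..<n}. chebR (real k / real n)) z = 0"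
      using k z unfolding poly_prod by (intro prod_zero) (auto simp: chebR_def)
    ultimately show "poly (chebS n) z = poly (\<Prod>k\<in>{1..<n}. chebR (real k / real n)) z" by simp
  qed (use deg chebS_degree(1) in auto)
qed

definition chebP :: "nat \<Rightarrow> complex poly" where
  "chebP m = (\<Prod>k\<in>{k\<in>{1..<m}. coprime k m}. chebR (real k / real m))"

lemma chebS_prod_chebP:
  assumes "n > 0"
  shows "chebS n = (\<Prod>m | m dvd n. chebP m)"
proof -
  let ?g = "\<lambda>k. n div gcd k n"
  have "chebP m = (\<Prod>k\<in>{k\<in>{1..<n}. ?g k = m}. chebR (real k / real n))" if mn: "m dvd n" for m
  proof -
    obtain d where d: "n = m * d" using mn by (elim dvdE)
    have pos: "m > 0" "d > 0" using assms d by auto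
    have *: "k * d \<in> {k\<in>{1..<n}. ?g k = m}" if "k \<in> {1..<m}" "coprime k m" for k
    proof -
      have "gcd (k * d) n = d"
        using that gcd_mult_distrib_nat[of d k m] by (simp add: d mult.commute[of _ d])
      then show ?thesis using that pos by (simp add: d)
    qed
    have **: "\<exists>j. j \<in> {1..<m} \<and> coprime j m \<and> k = j * d"
      if "k \<in> {1..<n}" "?g k = m" for k
    proof -
      have "m * gcd k n = n" using that(2) dvd_div_mult_self[OF gcd_dvd2[of k n]] by simp
      then have g: "gcd k n = d" using pos unfolding d by (metis mult_left_cancel less_not_refl)
      then obtain j where j: "k = j * d" by (metis dvdE gcd_dvd1 mult.commute)
      have "d * gcd j m = d"
        using g gcd_mult_distrib_nat[of d j m] by (simp add: j d mult.commute[of _ d])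
      then have "coprime j m" using pos by (simp add: coprime_iff_gcd_eq_1)
      then show ?thesis using that j d by auto
    qed
    have "bij_betw (\<lambda>k. k * d) {k\<in>{1..<m}. coprime k m} {k\<in>{1..<n}. ?g k = m}"
      unfolding bij_betw_def
    proof
      show "inj_on (\<lambda>k. k * d) {k\<in>{1..<m}. coprime k m}" using pos by (auto intro: inj_onI)
      show "(\<lambda>k. k * d) ` {k\<in>{1..<m}. coprime k m} = {k\<in>{1..<n}. ?g k = m}"
      proof (intro equalityI subsetI)
        fix y assume "y \<in> (\<lambda>k. k * d) ` {k\<in>{1..<m}. coprime k m}"
        then show "y \<in> {k\<in>{1..<n}. ?g k = m}" using * by blast
      next
        fix y assume "y \<in> {k\<in>{1..<n}. ?g k = m}"
        then show "y \<in> (\<lambda>k. k * d) ` {k\<in>{1..<m}. coprime k m}" using **[of y] by blast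
      qed
    qed
    from prod.reindex_bij_betw[OF this, of "\<lambda>k. chebR (real k / real n)"] show ?thesis
      using pos by (simp add: chebP_def d)
  qed
  then have "(\<Prod>m | m dvd n. chebP m) =
      (\<Prod>m | m dvd n. \<Prod>k\<in>{k\<in>{1..<n}. ?g k = m}. chebR (real k / real n))" by simp
  also have "\<dots> = (\<Prod>k\<in>{1..<n}. chebR (real k / real n))"
  proof (rule prod.group)
    have "?g k dvd n" for k by (metis dvd_div_mult_self dvd_triv_left gcd_dvd2)
    then show "?g ` {1..<n} \<subseteq> {m. m dvd n}" by blast
  qed (use assms in auto)
  finally show ?thesis using chebS_prod[OF assms] by simp
qed

lemma pell_v_nonzero:
  assumes "pell_solution D u v" "v \<noteq> 0" "degree D > 0" "n > 0"
  shows "pell_v D u v n \<noteq> 0"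
proof -
  have "degree u > 0" using pell_solution_degree[OF assms(1-3)] assms(3) by linarith
  moreover have "chebS n \<noteq> 0" using chebS_prod[OF assms(4)] by (simp add: degree_chebR)
  ultimately show ?thesis using assms pell_v_chebS by (simp add: pcompose_eq_0_iff)
qed

lemma pell_v_new_unique:
  assumes sol: "pell_solution D u v" "v \<noteq> 0" "degree D > 0"
    and w: "\<And>n. n > 0 \<Longrightarrow> pell_v D u v n = (\<Prod>m | m dvd n. w m)"
    and n: "n > 0"
  shows "pell_v_new D u v n = w n"
  using n
proof (induction n rule: less_induct)
  case (less n)
  let ?M = "{m. m dvd n \<and> m < n}"
  have wnz: "w m \<noteq> 0" if "m > 0" for m
    using pell_v_nonzero[OF sol that] w[OF that] that by auto
  have "{m. m dvd n} = insert n ?M" using less.prems by (auto dest: dvd_imp_le)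
  then have "pell_v D u v n = w n * (\<Prod>m\<in>?M. w m)" using w[OF less.prems] by simp
  moreover have "(\<Prod>m\<in>?M. w m) \<noteq> 0" using less.prems by (auto simp: wnz dvd_pos_nat)
  moreover have "(\<Prod>m\<in>?M. pell_v_new D u v m) = (\<Prod>m\<in>?M. w m)"
    using less by (intro prod.cong) (auto simp: dvd_pos_nat)
  ultimately show ?case by (simp add: pell_v_new.simps[of D u v n])
qed

theorem pell_v_eq_prod_new:
  assumes sol: "pell_solution D u v" "v \<noteq> 0" "degree D > 0" and n: "n > 0"
  shows "pell_v D u v n = (\<Prod>m | m dvd n. pell_v_new D u v m)"
proof -
  define w where "w m = (if m = 1 then v else 1) * pcompose (chebP m) u" for m
  have w: "pell_v D u v k = (\<Prod>m | m dvd k. w m)" if "k > 0" for k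
  proof -
    have "(\<Prod>m | m dvd k. if m = 1 then v else 1) = v"
      using that by (subst prod.delta) auto
    then show ?thesis
      using that by (simp add: w_def prod.distrib pell_v_chebS[OF sol(1)] chebS_prod_chebP pcompose_prod)
  qed
  show ?thesis
    using w[OF n] pell_v_new_unique[OF sol w] n by (auto intro!: prod.cong simp: dvd_pos_nat)
qed

end

theory Submission
  imports Defs
begin

text \<open>
  A rational linear or quadratic divisor of \<open>v\<^sub>n\<^sup>n\<^sup>e\<^sup>w\<close> has a root \<open>z\<close> of degree at most two over \<open>\<rat>\<close>, and
  \<open>2u(z) = 2cos(\<pi>k/n)\<close> with \<open>k\<close> coprime to \<open>n\<close>. This number is a root of a monic integer polynomial
  all of whose roots lie in the open interval from \<open>-2\<close> to \<open>2\<close>. By Gauss's lemma its minimal polynomial is integral,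
  and the bound on the conjugates leaves only the integers \<open>-1, 0, 1\<close> and the roots of \<open>x\<^sup>2 - 2\<close>,
  \<open>x\<^sup>2 - 3\<close> and \<open>x\<^sup>2 \<plusminus> x - 1\<close>, which occur for \<open>n \<le> 3\<close> and for \<open>n = 4, 6, 5\<close>.
\<close>

section \<open>Rational and integer polynomials inside the complex ones\<close>

lemma rational_poly_pCons [simp]:
  "rational_poly (pCons c p) \<longleftrightarrow> c \<in> \<rat> \<and> rational_poly p"
  unfolding rational_poly_def by (auto simp: coeff_pCons split: nat.splits)

lemma rational_poly_0 [simp]: "rational_poly 0"
  by (simp add: rational_poly_def)

lemma rational_poly_map_of_int: "rational_poly (map_poly of_int P)"
  by (simp add: rational_poly_def coeff_map_poly)

lemma map_poly_of_int_mult: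
  "map_poly of_int (p * q) =
    (map_poly of_int p * map_poly of_int q :: 'a :: {comm_ring_1, ring_char_0} poly)"
  by (rule poly_eqI) (simp add: coeff_map_poly coeff_mult)

lemma map_poly_of_int_diff:
  "map_poly of_int (p - q) =
    (map_poly of_int p - map_poly of_int q :: 'a :: {comm_ring_1, ring_char_0} poly)"
  by (rule poly_eqI) (simp add: coeff_map_poly)

lemma map_poly_of_int_eq_iff:
  "map_poly of_int p = (map_poly of_int q :: 'a :: {comm_ring_1, ring_char_0} poly) \<longleftrightarrow> p = q"
  by (simp add: poly_eq_iff coeff_map_poly)

lemma rational_poly_clear_denominators:
  assumes "rational_poly p"
  shows "\<exists>N>0. \<exists>P. smult (of_int N) p = map_poly of_int P"
  using assms
proof (induction p)
  case 0
  have "smult (of_int 1) 0 = map_poly of_int 0" by simp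
  then show ?case using zero_less_one by blast
next
  case (pCons c p)
  then obtain N P where N: "N > 0" "smult (of_int N) p = map_poly of_int P" by auto
  from pCons have "c \<in> \<rat>" by simp
  then obtain a b where ab: "b > 0" "c = of_int a / of_int b" by (rule Rats_cases')
  have "smult (of_int (N * b)) (pCons c p) =
          pCons (of_int (a * N)) (smult (of_int b) (smult (of_int N) p))"
    using ab by (simp add: mult.commute)
  also have "\<dots> = map_poly of_int (pCons (a * N) (smult b P))"
    unfolding N(2) by (rule poly_eqI) (simp add: coeff_map_poly coeff_pCons split: nat.splits)
  finally show ?case using N(1) ab(1) by (metis mult_pos_pos)
qed

text \<open>
  Gauss's lemma for monic factors: after clearing denominators by \<open>N\<close> and \<open>M\<close>, the contents of
  the factors divide \<open>N\<close> and \<open>M\<close> and have product \<open>N * M\<close>, so \<open>N\<close> divides its factor.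
\<close>

lemma monic_rational_factor_integral:
  assumes P: "lead_coeff P = 1" and eq: "map_poly of_int P = g * h"
    and rat: "rational_poly g" "rational_poly h" and g: "lead_coeff g = 1"
  shows "coeff g i \<in> \<int>"
proof -
  obtain N G where N: "N > 0" "smult (of_int N) g = map_poly of_int G"
    using rational_poly_clear_denominators[OF rat(1)] by blast
  obtain M H where M: "M > 0" "smult (of_int M) h = map_poly of_int H"
    using rational_poly_clear_denominators[OF rat(2)] by blast
  have "lead_coeff (map_poly of_int P :: complex poly) = 1"
    using P by (simp add: degree_map_poly coeff_map_poly)
  then have h: "lead_coeff h = 1" unfolding eq lead_coeff_mult using g by simp
  have "map_poly of_int (smult (N * M) P) = smult (of_int (N * M)) (g * h)"
    unfolding eq[symmetric] by (rule poly_eqI) (simp add: coeff_map_poly)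
  also have "\<dots> = smult (of_int N) g * smult (of_int M) h" by (simp add: mult.commute)
  also have "\<dots> = map_poly of_int (G * H)" unfolding N(2) M(2) map_poly_of_int_mult ..
  finally have GH: "smult (N * M) P = G * H" by (simp only: map_poly_of_int_eq_iff)
  have "content P dvd 1" using content_dvd_coeff[of P "degree P"] P by simp
  then have "content P = 1" by (metis is_unit_normalize normalize_content)
  then have NM: "N * M = content G * content H"
    using arg_cong[OF GH, of content] N(1) M(1) by (simp add: content_mult)
  \<comment> \<open>Since \<open>g\<close> is monic, \<open>N\<close> itself is a coefficient of
    \<open>G\<close>, so the content of \<open>G\<close> divides it.\<close>
  have "coeff (map_poly of_int G) (degree g) = complex_of_int N"
    unfolding N(2)[symmetric] using g by simp
  then have "coeff G (degree g) = N" by (simp add: coeff_map_poly)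
  then have cG: "content G dvd N" by (metis content_dvd_coeff)
  have "coeff (map_poly of_int H) (degree h) = complex_of_int M"
    unfolding M(2)[symmetric] using h by simp
  then have "coeff H (degree h) = M" by (simp add: coeff_map_poly)
  then have cH: "content H dvd M" by (metis content_dvd_coeff)
  have "N dvd content G"
  proof -
    obtain m where m: "M = content H * m" using cH by (elim dvdE)
    have "N * m * content H = content G * content H" using NM m by (simp add: algebra_simps)
    moreover have "content H \<noteq> 0" using m M(1) by auto
    ultimately have "N * m = content G" by simp
    then show ?thesis by (metis dvd_triv_left)
  qed
  then have "N dvd coeff G i" using content_dvd_coeff dvd_trans by blast
  then obtain c where "coeff G i = N * c" by (elim dvdE)
  moreover have "of_int N * coeff g i = of_int (coeff G i)"
    using arg_cong[OF N(2), of "\<lambda>p. coeff p i"] by (simp add: coeff_map_poly)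
  ultimately have "coeff g i = of_int c" using N(1) by simp
  then show ?thesis by simp
qed

text \<open>Reduction modulo a monic quadratic whose roots have sum \<open>s\<close> and product
  \<open>p\<close>: prepending a coefficient multiplies the remainder by \<open>t\<close>, and
  \<open>t^2\<close> reduces to \<open>s t - p\<close>. It serves both to factor
  \<open>chebZ n\<close> and to evaluate \<open>u\<close> at a quadratic irrationality.\<close>

lemma rational_poly_quadratic_division:
  assumes "rational_poly P" "s \<in> \<rat>" "p \<in> \<rat>"
  shows "\<exists>h a b. rational_poly h \<and> a \<in> \<rat> \<and> b \<in> \<rat> \<and> P = [:p, -s, 1:] * h + [:a, b:]"
  using assms(1)
proof (induction P)
  case 0
  have "0 = [:p, -s, 1:] * 0 + [:0, 0:]" by simp
  then show ?case using rational_poly_0 Rats_0 by blast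
next
  case (pCons c P)
  then obtain h a b where h: "rational_poly h" "a \<in> \<rat>" "b \<in> \<rat>" "P = [:p, -s, 1:] * h + [:a, b:]"
    by auto
  have "pCons c P = [:p, -s, 1:] * pCons b h + [:c - b * p, a + b * s:]"
    unfolding h(4) by (simp add: algebra_simps)
  moreover have "rational_poly (pCons b h)" "c - b * p \<in> \<rat>" "a + b * s \<in> \<rat>"
    using h pCons.prems assms by auto
  ultimately show ?case by blast
qed

section \<open>Integer Chebyshev polynomials and their roots\<close>

text \<open>
  The monic integer polynomial \<open>chebS n\<close> rescaled to have the roots \<open>2cos(\<pi>k/n)\<close>.
\<close>

fun chebZ :: "nat \<Rightarrow> int poly" where
  "chebZ 0 = 0"
| "chebZ (Suc 0) = 1"
| "chebZ (Suc (Suc n)) = pCons 0 (chebZ (Suc n)) - chebZ n"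

lemma chebZ_monic: "degree (chebZ (Suc n)) = n \<and> lead_coeff (chebZ (Suc n)) = 1"
proof (induction n rule: less_induct)
  case (less n)
  show ?case
  proof (cases n)
    case (Suc m)
    \<comment> \<open>For \<open>m = 0\<close> the zero polynomial has degree 0, still below
      \<open>n = 1\<close>; otherwise the induction hypothesis at \<open>m - 1\<close>
      applies.\<close>
    have small: "degree (chebZ m) < n"
      using less[of "m - 1"] Suc by (cases m) auto
    have IH: "degree (chebZ (Suc m)) = m" "lead_coeff (chebZ (Suc m)) = 1"
      using less[of m] Suc by auto
    then have "degree (pCons 0 (chebZ (Suc m))) = n"
      using Suc by (subst degree_pCons_eq) auto
    moreover from this have "degree (chebZ (Suc n)) = n"
      using small Suc by (simp add: degree_add_eq_left flip: add_uminus_conv_diff)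
    ultimately show ?thesis
      using IH small Suc by (simp add: coeff_eq_0)
  qed simp
qed

lemma poly_chebZ:
  "poly (map_poly of_int (chebZ n)) (2 * z) = poly (chebS n) (z :: complex)"
  by (induction n rule: chebS.induct)
     (simp_all add: map_poly_pCons map_poly_of_int_diff)

lemma poly_chebZ_2cos:
  assumes "1 \<le> k" "k < n"
  shows "poly (map_poly of_int (chebZ n)) (of_real (2 * cos (pi * (real k / real n)))) = (0 :: complex)"
proof -
  have "poly (chebS n) (complex_of_real (cos (pi * (real k / real n)))) = 0"
    using assms by (auto simp: chebS_prod poly_prod chebR_def)
  then show ?thesis using poly_chebZ[of n "of_real (cos (pi * (real k / real n)))"] by simp
qed

text \<open>Confines every conjugate of a number \<open>2cos(\<pi>k/n)\<close> to the same real
  family, so that bounds on the family apply to it.\<close>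

lemma poly_chebZ_eq_0D:
  assumes "poly (map_poly of_int (chebZ n)) x = (0 :: complex)" "n > 0"
  shows "\<exists>k\<in>{1..<n}. x = of_real (2 * cos (pi * (real k / real n)))"
proof -
  have "poly (chebS n) (x / 2) = 0" using assms(1) poly_chebZ[of n "x / 2"] by simp
  then show ?thesis using assms(2) by (auto simp: chebS_prod poly_prod chebR_def)
qed

lemma abs_2cos_less_2:
  assumes "1 \<le> k" "k < n"
  shows "\<bar>2 * cos (pi * (real k / real n))\<bar> < 2"
proof -
  have "pi * (real k / real n) < pi * 1"
    using assms by (intro mult_strict_left_mono) auto
  then have "sin (pi * (real k / real n)) > 0"
    using assms by (intro sin_gt_zero) auto
  then have "(cos (pi * (real k / real n)))\<^sup>2 < 1"
    by (smt (verit) sin_cos_squared_add zero_less_power)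
  then show ?thesis by (simp add: abs_square_less_1)
qed

text \<open>By \<open>chebS_cos\<close>, a root forces \<open>sin(m\<pi>k/n) = 0\<close>, so
  \<open>n\<close> divides \<open>m k\<close>, and coprimality removes \<open>k\<close>. This
  recovers \<open>n\<close> from an explicit small equation for the cosine.\<close>

lemma chebS_root_imp_dvd:
  assumes "1 \<le> k" "k < n" "coprime k n"
    and "poly (chebS m) (of_real (cos (pi * (real k / real n)))) = 0"
  shows "n dvd m"
proof -
  have "sin (real m * (pi * (real k / real n))) = 0"
    using chebS_cos[of m "pi * (real k / real n)"] assms(4) by simp
  then have "sin ((real m * real k / real n) * pi) = 0" by (simp add: mult.commute mult.left_commute)
  then have "real m * real k / real n \<in> \<int>" by (simp only: sin_times_pi_eq_0)
  then obtain j where "real m * real k / real n = of_int j" by (elim Ints_cases)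
  then have "of_int (int (m * k)) = (of_int (j * int n) :: real)" using assms by (simp add: field_simps)
  then have "int (m * k) = j * int n" by (simp only: of_int_eq_iff)
  then have "int n dvd int (m * k)" by simp
  then have "n dvd m * k" by (simp only: int_dvd_int_iff)
  then show ?thesis using assms(3) by (simp add: coprime_dvd_mult_left_iff coprime_commute)
qed

section \<open>Cosine values of degree at most two\<close>

text \<open>A rational algebraic integer is an integer, and the bound 2 leaves -1, 0 and 1, whose
  halves are roots of \<open>chebS 2\<close> or \<open>chebS 3\<close>.\<close>

lemma rational_2cos_imp_le_3:
  fixes k n :: nat
  defines "y \<equiv> 2 * cos (pi * (real k / real n))"
  assumes k: "1 \<le> k" "k < n" "coprime k n" and rat: "complex_of_real y \<in> \<rat>"
  shows "n \<le> 3"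
proof -
  obtain m where "n = Suc m" using k by (cases n) auto
  then have "algebraic_int (complex_of_real y)"
    using poly_chebZ_2cos[OF k(1,2)] chebZ_monic[of m]
    unfolding algebraic_int_altdef_ipoly y_def by blast
  then have "complex_of_real y \<in> \<int>" using rat by (rule rational_algebraic_int_is_int)
  then obtain j where "complex_of_real y = of_int j" by (elim Ints_cases)
  then have j: "y = of_int j" by (metis of_real_eq_iff of_real_of_int_eq)
  have "\<bar>y\<bar> < 2" unfolding y_def by (rule abs_2cos_less_2[OF k(1,2)])
  then have "j \<in> {-1, 0, 1}" unfolding j by auto
  define c where "c = complex_of_real (cos (pi * (real k / real n)))"
  have "2 * c = of_int j" using \<open>complex_of_real y = of_int j\<close> by (simp add: c_def y_def)
  moreover have "poly (chebS 2) c = 2 * c" "poly (chebS 3) c = (2 * c - 1) * (2 * c + 1)"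
    by (simp_all add: numeral_eq_Suc algebra_simps)
  ultimately have "poly (chebS 2) c = 0 \<or> poly (chebS 3) c = 0"
    using \<open>j \<in> {-1, 0, 1}\<close> by auto
  then have "n dvd 2 \<or> n dvd 3" using chebS_root_imp_dvd[OF k] unfolding c_def by blast
  then show ?thesis by (auto dest: dvd_imp_le)
qed

text \<open>If \<open>y\<close> is irrational, the quadratic divides \<open>chebZ n\<close>, so its
  coefficients are integers and its other root \<open>z\<close> also lies between -2 and 2. Only
  finitely many pairs of sum \<open>S\<close> and product \<open>Q\<close> remain.\<close>

lemma quadratic_2cos_imp_le_6:
  fixes k n :: nat
  defines "y \<equiv> 2 * cos (pi * (real k / real n))"
  assumes k: "1 \<le> k" "k < n" "coprime k n" and sp: "s \<in> \<rat>" "p \<in> \<rat>"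
    and eq: "(complex_of_real y)\<^sup>2 - s * of_real y + p = 0"
  shows "n \<le> 6"
proof (cases "complex_of_real y \<in> \<rat>")
  case True
  then show ?thesis using rational_2cos_imp_le_3[OF k] unfolding y_def by simp
next
  case irrat: False
  obtain m where m: "n = Suc m" using k by (cases n) auto
  define P where "P = chebZ n"
  have P: "lead_coeff P = 1" unfolding P_def m using chebZ_monic by blast
  have root: "poly (map_poly of_int P) (complex_of_real y) = 0"
    unfolding P_def y_def by (rule poly_chebZ_2cos[OF k(1,2)])
  obtain h a b where h: "rational_poly h" "a \<in> \<rat>" "b \<in> \<rat>"
      "map_poly of_int P = [:p, -s, 1:] * h + [:a, b:]"
    using rational_poly_quadratic_division[OF rational_poly_map_of_int sp] by blast
  have g0: "poly [:p, -s, 1:] (complex_of_real y) = 0"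
    using eq by (simp add: power2_eq_square algebra_simps)
  then have ab: "a + b * of_real y = 0"
    using root unfolding h(4) poly_add poly_mult by (simp add: mult.commute)
  \<comment> \<open>The remainder of the division vanishes at \<open>y\<close>; a nonzero linear
    coefficient would make \<open>y\<close> rational.\<close>
  have "b = 0"
  proof (rule ccontr)
    assume "b \<noteq> 0"
    then have "complex_of_real y = - a / b" using ab by (simp add: field_simps eq_neg_iff_add_eq_0)
    then show False using irrat h by auto
  qed
  then have fac: "map_poly of_int P = [:p, -s, 1:] * h" using ab h(4) by simp
  have "coeff [:p, -s, 1:] i \<in> \<int>" for i
    by (rule monic_rational_factor_integral[OF P fac]) (use sp h in auto)
  from this[of 0] this[of 1] have "p \<in> \<int>" "s \<in> \<int>" by simp_all
  then obtain S Q where SQ: "s = of_int S" "p = of_int Q" by (elim Ints_cases)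
  \<comment> \<open>The conjugate \<open>s - y\<close> is a root of the divisor, hence again twice a
    cosine.\<close>
  have "poly [:p, -s, 1:] (s - complex_of_real y) = 0" using g0 by (simp add: algebra_simps)
  then have "poly (map_poly of_int P) (s - complex_of_real y) = 0" unfolding fac poly_mult by simp
  then obtain i where i: "i \<in> {1..<n}"
      "s - complex_of_real y = of_real (2 * cos (pi * (real i / real n)))"
    using poly_chebZ_eq_0D[of n] m unfolding P_def by blast
  define z where "z = 2 * cos (pi * (real i / real n))"
  have "complex_of_real (of_int S) = of_real (y + z)" using i SQ z_def by (simp add: algebra_simps)
  then have S: "of_int S = y + z" by (simp only: of_real_eq_iff)
  have "complex_of_real (y\<^sup>2 - of_int S * y + of_int Q) = 0" using eq SQ by simp
  then have yq: "y\<^sup>2 - of_int S * y + of_int Q = 0" by (simp only: of_real_eq_0_iff)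
  then have Q: "of_int Q = y * z" unfolding S by (simp add: algebra_simps power2_eq_square)
  have y2: "\<bar>y\<bar> < 2" unfolding y_def by (rule abs_2cos_less_2[OF k(1,2)])
  have z2: "\<bar>z\<bar> < 2" unfolding z_def by (rule abs_2cos_less_2) (use i in auto)
  have irr: "y \<notin> \<rat>" using irrat by (auto elim!: Rats_cases)
  have "y \<noteq> z"
  proof
    assume "y = z"
    then have "y = of_int S / 2" using S by simp
    moreover have "real_of_int S / 2 \<in> \<rat>" by simp
    ultimately show False using irr by metis
  qed
  \<comment> \<open>The discriminant of the quadratic is positive because its roots are real and
    distinct.\<close>
  then have "(y - z)\<^sup>2 > 0" by simp
  then have "of_int (S\<^sup>2 - 4 * Q) > (0 :: real)"
    by (simp add: S Q power2_eq_square algebra_simps)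
  then have disc: "4 * Q < S\<^sup>2" by (simp only: of_int_0_less_iff)
  \<comment> \<open>These are the values of the quadratic at 2 and -2.\<close>
  have "(2 - y) * (2 - z) > 0" "(2 + y) * (2 + z) > 0" using y2 z2 by auto
  then have "of_int (4 - 2 * S + Q) > (0 :: real)" "of_int (4 + 2 * S + Q) > (0 :: real)"
    by (simp_all add: S Q algebra_simps)
  then have ends: "4 - 2 * S + Q > 0" "4 + 2 * S + Q > 0" by (simp_all only: of_int_0_less_iff)
  have "\<bar>of_int S :: real\<bar> < 4" using S y2 z2 by linarith
  then have "\<bar>S\<bar> < 4" by linarith
  then have "S \<in> {-3, -2, -1, 0, 1, 2, 3}" by auto
  then have "S = 0 \<and> Q \<in> {-1, -2, -3} \<or> \<bar>S\<bar> = 1 \<and> Q \<in> {-1, 0}"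
    using disc ends by auto
  moreover have "Q \<noteq> 0"
  proof
    assume "Q = 0"
    then have "y = 0 \<or> y = of_int S" using Q S by auto
    then show False using irr by auto
  qed
  moreover have "\<not> (S = 0 \<and> Q = -1)"
  proof
    assume "S = 0 \<and> Q = -1"
    then have "y\<^sup>2 = 1" using yq by simp
    then show False using irr by (auto simp: power2_eq_1_iff)
  qed
  ultimately have cases: "S = 0 \<and> Q = -2 \<or> S = 0 \<and> Q = -3 \<or> \<bar>S\<bar> = 1 \<and> Q = -1" by auto
  define c where "c = complex_of_real (cos (pi * (real k / real n)))"
  have yc: "complex_of_real y = 2 * c" by (simp add: y_def c_def)
  have c: "4 * c\<^sup>2 = 2 * of_int S * c - of_int Q"
    using eq unfolding yc SQ by (simp add: power2_eq_square algebra_simps)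
  \<comment> \<open>With \<open>x = 2c\<close>, the factors include \<open>x^2 - 2\<close> for index
    4, \<open>x^2 - 3\<close> for index 6, and \<open>x^2 - x - 1\<close> and
    \<open>x^2 + x - 1\<close> for index 5.\<close>
  have "poly (chebS 4) c = 4 * c * (2 * c\<^sup>2 - 1)" "poly (chebS 6) c = 2 * c * (4 * c\<^sup>2 - 1) * (4 * c\<^sup>2 - 3)"
    "poly (chebS 5) c = (4 * c\<^sup>2 - 2 * c - 1) * (4 * c\<^sup>2 + 2 * c - 1)"
    by (simp_all add: numeral_eq_Suc algebra_simps)
  then have "poly (chebS 4) c = 0 \<or> poly (chebS 6) c = 0 \<or> poly (chebS 5) c = 0"
    using cases c by (auto simp: abs_if split: if_splits)
  then have "n dvd 4 \<or> n dvd 6 \<or> n dvd 5" using chebS_root_imp_dvd[OF k] unfolding c_def by blast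
  then show ?thesis by (auto dest: dvd_imp_le)
qed

section \<open>Roots of the new part and values of \<open>u\<close> there\<close>

lemma pell_v_new_chebP:
  assumes sol: "pell_solution D u v" "v \<noteq> 0" "degree D > 0" and n: "n > 1"
  shows "pell_v_new D u v n = pcompose (chebP n) u"
proof -
  \<comment> \<open>The factor \<open>v\<close> of \<open>pell_v\<close> is assigned to index 1, so
    for larger indices only the Chebyshev part remains.\<close>
  define w where "w m = (if m = 1 then v else 1) * pcompose (chebP m) u" for m
  have "pell_v D u v k = (\<Prod>m | m dvd k. w m)" if "k > 0" for k
  proof -
    have "(\<Prod>m | m dvd k. if m = 1 then v else 1) = v"
      using that by (subst prod.delta) auto
    then show ?thesis
      using that by (simp add: w_def prod.distrib pell_v_chebS[OF sol(1)] chebS_prod_chebP pcompose_prod)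
  qed
  from pell_v_new_unique[OF sol this, of n] n show ?thesis by (simp add: w_def)
qed

lemma pell_v_new_root:
  assumes "pell_solution D u v" "v \<noteq> 0" "degree D > 0" "n > 1"
    and "q dvd pell_v_new D u v n" "poly q z = 0"
  shows "\<exists>k. 1 \<le> k \<and> k < n \<and> coprime k n \<and> 2 * poly u z = of_real (2 * cos (pi * (real k / real n)))"
proof -
  have "poly (pcompose (chebP n) u) z = 0"
    using assms(5,6) unfolding pell_v_new_chebP[OF assms(1-4)] by (auto elim!: dvdE)
  then show ?thesis by (auto simp: poly_pcompose chebP_def poly_prod chebR_def)
qed

lemma rational_poly_value:
  assumes "rational_poly u" "z \<in> \<rat>"
  shows "poly u z \<in> \<rat>"
  using assms by (induction u) auto

text \<open>Modulo the quadratic of \<open>z\<close>, \<open>u\<close> becomes linear, and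
  \<open>2(a + b z)\<close> has rational trace and norm over the two roots; these are
  \<open>s'\<close> and \<open>p'\<close>.\<close>

lemma rational_poly_value_quadratic:
  assumes "rational_poly u" "s \<in> \<rat>" "p \<in> \<rat>" "z\<^sup>2 - s * z + p = 0"
  shows "\<exists>s'\<in>\<rat>. \<exists>p'\<in>\<rat>. (2 * poly u z)\<^sup>2 - s' * (2 * poly u z) + p' = 0"
proof -
  obtain h a b where h: "a \<in> \<rat>" "b \<in> \<rat>" "u = [:p, -s, 1:] * h + [:a, b:]"
    using rational_poly_quadratic_division[OF assms(1-3)] by blast
  have "poly [:p, -s, 1:] z = 0"
    using assms(4) by (simp add: power2_eq_square algebra_simps)
  then have uz: "poly u z = a + b * z" unfolding h(3) poly_add poly_mult by (simp add: mult.commute)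
  have "(2 * poly u z)\<^sup>2 - (4 * a + 2 * b * s) * (2 * poly u z) + (4 * (a\<^sup>2 + a * b * s + b\<^sup>2 * p)) =
     4 * b\<^sup>2 * (z\<^sup>2 - s * z + p)"
    unfolding uz by (simp add: power2_eq_square algebra_simps)
  also have "\<dots> = 0" using assms(4) by simp
  finally have "(2 * poly u z)\<^sup>2 - (4 * a + 2 * b * s) * (2 * poly u z) +
      (4 * (a\<^sup>2 + a * b * s + b\<^sup>2 * p)) = 0" .
  moreover have "4 * a + 2 * b * s \<in> \<rat>" "4 * (a\<^sup>2 + a * b * s + b\<^sup>2 * p) \<in> \<rat>"
    using h assms by auto
  ultimately show ?thesis by blast
qed

theorem theorem0p3:
  fixes D u v :: "complex poly"
  assumes "rational_poly D" and "degree D > 0"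
    and "fundamental_solution D u v" and "rational_poly u" and "rational_poly v"
  shows "(\<forall>n\<ge>4. \<not> (\<exists>l. rational_poly l \<and> degree l = 1 \<and> l dvd pell_v_new D u v n)) \<and>
         (\<forall>n\<ge>7. \<not> (\<exists>q. rational_poly q \<and> degree q = 2 \<and> q dvd pell_v_new D u v n))"
proof (intro conjI allI impI)
  have sol: "pell_solution D u v" "v \<noteq> 0" "degree D > 0"
    using assms(2,3) by (simp_all add: fundamental_solution_def)
  show "\<not> (\<exists>l. rational_poly l \<and> degree l = 1 \<and> l dvd pell_v_new D u v n)" if n: "n \<ge> 4" for n
  proof
    assume "\<exists>l. rational_poly l \<and> degree l = 1 \<and> l dvd pell_v_new D u v n"
    then obtain q where q: "rational_poly q" "q dvd pell_v_new D u v n" and deg: "degree q = 1"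
      by blast
    obtain a b where ab: "q = [:a, b:]" "b \<noteq> 0" using degree1_coeffs[OF deg] .
    then have "- a / b \<in> \<rat>" and "poly q (- a / b) = 0" using q by auto
    moreover have "n > 1" using n by simp
    ultimately obtain k where k: "1 \<le> k" "k < n" "coprime k n"
        and "2 * poly u (- a / b) = of_real (2 * cos (pi * (real k / real n)))"
      using pell_v_new_root[OF sol _ q(2)] by blast
    moreover have "2 * poly u (- a / b) \<in> \<rat>"
      using rational_poly_value[OF assms(4) \<open>- a / b \<in> \<rat>\<close>] by simp
    ultimately show False using rational_2cos_imp_le_3[OF k] n by simp
  qed
  show "\<not> (\<exists>q. rational_poly q \<and> degree q = 2 \<and> q dvd pell_v_new D u v n)" if n: "n \<ge> 7" for n
  proof
    assume "\<exists>q. rational_poly q \<and> degree q = 2 \<and> q dvd pell_v_new D u v n"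
    then obtain q where q: "rational_poly q" "q dvd pell_v_new D u v n" and deg: "degree q = 2"
      by blast
    obtain a b c where abc: "q = [:c, b, a:]" "a \<noteq> 0" using degree2_coeffs[OF deg] .
    \<comment> \<open>Any complex root will do, even if \<open>q\<close> is reducible:
      \<open>quadratic_2cos_imp_le_6\<close> also covers rational values.\<close>
    obtain z where z: "poly q z = 0"
      using fundamental_theorem_of_algebra[of q] deg by (auto simp: constant_degree)
    have "z\<^sup>2 - (- b / a) * z + c / a = 0"
      using z abc by (simp add: field_simps power2_eq_square)
    moreover have "- b / a \<in> \<rat>" "c / a \<in> \<rat>" using abc q by auto
    ultimately obtain s p where sp: "s \<in> \<rat>" "p \<in> \<rat>"
        and eq: "(2 * poly u z)\<^sup>2 - s * (2 * poly u z) + p = 0"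
      using rational_poly_value_quadratic[OF assms(4)] by blast
    have "n > 1" using n by simp
    then obtain k where k: "1 \<le> k" "k < n" "coprime k n"
        and uz: "2 * poly u z = of_real (2 * cos (pi * (real k / real n)))"
      using pell_v_new_root[OF sol _ q(2) z] by blast
    have "n \<le> 6" by (rule quadratic_2cos_imp_le_6[OF k sp eq[unfolded uz]])
    then show False using n by simp
  qed
qed

end
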